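(* Let $g\ge 1$, let $V\subset(\mathbb{P}^1)^g$ be a subvariety defined over $\mathbb{Q}$, and let $\Phi:=(f_1,\dots,f_g)$ act on $\mathbb{A}^g$ coordinatewise, where $f_i(t)=t^2+c_i$ with $c_i\in\mathbb{Z}$ for each $i$. Let $\mathcal{O}$ be the $\Phi$-orbit of a point $(x_1,\dots,x_g)\in\mathbb{Z}^g$. Then $V(\mathbb{Q})\cap\mathcal{O}$ is a union of at most finitely many orbits of the form $\{\Phi^{nk+\ell}(x_1,\dots,x_g)\}_{n\ge 0}$ for nonnegative integers $k$ and $\ell$.
   Context: $\mathbb{A}^g$ is regarded as a subset of $(\mathbb{P}^1)^g$ in the usual way. $\Phi^m$ denotes the $m$-th iterate of $\Phi$ ($\Phi^0$ is the identity), and the $\Phi$-orbit of $\alpha$ is the forward orbit $\{\Phi^m(\alpha): m\ge 0\}$. The value $k=0$ is allowed, giving singleton orbits. Subvarieties are closed and not necessarily irreducible. *)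

theory Defs
  imports "HOL-Analysis.Finite_Cartesian_Product" "HOL-Library.Poly_Mapping" Complex_Main
begin

definition proj_rel :: "complex \<times> complex \<Rightarrow> complex \<times> complex \<Rightarrow> bool" where
  "proj_rel u v \<longleftrightarrow> u \<noteq> (0, 0) \<and> v \<noteq> (0, 0) \<and>
     (\<exists>r. r \<noteq> 0 \<and> fst v = r * fst u \<and> snd v = r * snd u)"

lemma part_equivp_proj_rel: "part_equivp proj_rel"
proof (rule part_equivpI)
  show "\<exists>u :: complex \<times> complex. proj_rel u u"
    by (rule exI[of _ "(1, 1)"]) (auto simp: proj_rel_def intro: exI[of _ 1])
  show "symp proj_rel"
  proof (rule sympI)
    fix u v :: "complex \<times> complex"
    assume "proj_rel u v"
    then obtain r where "u \<noteq> (0, 0)" "v \<noteq> (0, 0)" "r \<noteq> 0"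
      "fst v = r * fst u" "snd v = r * snd u"
      by (auto simp: proj_rel_def)
    then show "proj_rel v u"
      unfolding proj_rel_def by (intro conjI exI[of _ "inverse r"]) auto
  qed
  show "transp proj_rel"
  proof (rule transpI)
    fix u v w :: "complex \<times> complex"
    assume "proj_rel u v" "proj_rel v w"
    then obtain r s where "u \<noteq> (0, 0)" "w \<noteq> (0, 0)" "r \<noteq> 0" "s \<noteq> 0"
      "fst v = r * fst u" "snd v = r * snd u" "fst w = s * fst v" "snd w = s * snd v"
      by (auto simp: proj_rel_def)
    then show "proj_rel u w"
      unfolding proj_rel_def by (intro conjI exI[of _ "s * r"]) auto
  qed
qed

text \<open>The complex points of the projective line.\<close>

quotient_type proj_line = "complex \<times> complex" / partial: proj_rel
  by (rule part_equivp_proj_rel)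

text \<open>The point \<open>[a : b]\<close>; meaningful only if \<open>(a, b) \<noteq> (0, 0)\<close>.\<close>

definition proj_pt :: "complex \<Rightarrow> complex \<Rightarrow> proj_line" where
  "proj_pt a b = abs_proj_line (a, b)"

lemma proj_pt_eq_iff:
  assumes "(a, b) \<noteq> (0, 0)" "(c, d) \<noteq> (0, 0)"
  shows "proj_pt a b = proj_pt c d \<longleftrightarrow> (\<exists>r. r \<noteq> 0 \<and> c = r * a \<and> d = r * b)"
proof -
  have nz: "proj_rel u u \<longleftrightarrow> u \<noteq> (0, 0)" for u :: "complex \<times> complex"
    by (auto simp: proj_rel_def intro: exI[of _ 1])
  have "proj_rel (a, b) (c, d) \<longleftrightarrow> proj_pt a b = proj_pt c d"
    using Quotient3_rel[OF Quotient3_proj_line, of "(a, b)" "(c, d)"] assms nz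
    by (auto simp: proj_pt_def)
  then show ?thesis
    using assms by (auto simp: proj_rel_def)
qed

lemma proj_pt_exhaust:
  obtains a b where "(a, b) \<noteq> (0, 0)" "P = proj_pt a b"
proof -
  obtain a b where ab: "rep_proj_line P = (a, b)"
    by fastforce
  have "proj_rel (a, b) (a, b)"
    using Quotient3_rep_reflp[OF Quotient3_proj_line, of P] ab by simp
  moreover have "P = proj_pt a b"
    using Quotient3_abs_rep[OF Quotient3_proj_line, of P] ab by (simp add: proj_pt_def)
  ultimately show ?thesis
    using that by (auto simp: proj_rel_def)
qed

text \<open>The homogeneous coordinates on the \<open>i\<close>-th factor of \<open>(P\<^sup>1)\<^sup>g\<close>, the factors being
  indexed by a finite type \<open>'g\<close>.\<close>

datatype 'g hvar = HX 'g | HY 'g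

type_synonym 'g hpoly = "('g hvar \<Rightarrow>\<^sub>0 nat) \<Rightarrow>\<^sub>0 rat"

definition multihomogeneous :: "'g hpoly \<Rightarrow> bool" where
  "multihomogeneous p \<longleftrightarrow> (\<exists>d. \<forall>m \<in> Poly_Mapping.keys p. \<forall>i.
     Poly_Mapping.lookup m (HX i) + Poly_Mapping.lookup m (HY i) = d i)"

definition hpoly_eval :: "'g hpoly \<Rightarrow> ('g hvar \<Rightarrow> complex) \<Rightarrow> complex" where
  "hpoly_eval p u = (\<Sum>m \<in> Poly_Mapping.keys p.
     of_rat (Poly_Mapping.lookup p m) * (\<Prod>v \<in> Poly_Mapping.keys m. u v ^ Poly_Mapping.lookup m v))"

definition homog_coords :: "('g::finite hvar \<Rightarrow> complex) \<Rightarrow> proj_line ^ 'g \<Rightarrow> bool" where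
  "homog_coords u P \<longleftrightarrow>
     (\<forall>i. (u (HX i), u (HY i)) \<noteq> (0, 0) \<and> P $ i = proj_pt (u (HX i)) (u (HY i)))"

text \<open>For multihomogeneous \<open>p\<close> this does not depend on the choice of homogeneous coordinates
  (see \<open>hpoly_vanishes_iff\<close> below).\<close>

definition hpoly_vanishes :: "'g::finite hpoly \<Rightarrow> proj_line ^ 'g \<Rightarrow> bool" where
  "hpoly_vanishes p P \<longleftrightarrow> (\<forall>u. homog_coords u P \<longrightarrow> hpoly_eval p u = 0)"

text \<open>A subvariety of \<open>(P\<^sup>1)\<^sup>g\<close> is identified with its set of complex points; it need be
  neither irreducible nor nonempty. By Noetherianity, arbitrary sets \<open>S\<close> of equations give the
  same subsets as finite ones.\<close>

definition subvariety_over_Q :: "(proj_line ^ 'g::finite) set \<Rightarrow> bool" where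
  "subvariety_over_Q V \<longleftrightarrow>
     (\<exists>S. (\<forall>p \<in> S. multihomogeneous p) \<and> V = {P. \<forall>p \<in> S. hpoly_vanishes p P})"

definition rational_points :: "(proj_line ^ 'g::finite) set \<Rightarrow> (proj_line ^ 'g) set" where
  "rational_points V = {P \<in> V. \<forall>i. \<exists>a b :: rat. (a, b) \<noteq> (0, 0) \<and> P $ i = proj_pt (of_rat a) (of_rat b)}"

definition affine_embed :: "complex ^ 'g::finite \<Rightarrow> proj_line ^ 'g" where
  "affine_embed z = (\<chi> i. proj_pt (z $ i) 1)"

definition quad_map :: "int ^ 'g::finite \<Rightarrow> complex ^ 'g \<Rightarrow> complex ^ 'g" where
  "quad_map c z = (\<chi> i. (z $ i)\<^sup>2 + of_int (c $ i))"

definition int_point :: "int ^ 'g::finite \<Rightarrow> complex ^ 'g" where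
  "int_point x = (\<chi> i. of_int (x $ i))"

definition forward_orbit :: "('a \<Rightarrow> 'a) \<Rightarrow> 'a \<Rightarrow> 'a set" where
  "forward_orbit f x = {(f ^^ m) x | m. True}"

lemma homog_coords_exist: "\<exists>u. homog_coords u P"
proof -
  have "\<forall>i. \<exists>a b. (a, b) \<noteq> (0, 0) \<and> P $ i = proj_pt a b"
  proof
    fix i
    obtain a b where "(a, b) \<noteq> (0, 0)" "P $ i = proj_pt a b"
      by (rule proj_pt_exhaust)
    then show "\<exists>a b. (a, b) \<noteq> (0, 0) \<and> P $ i = proj_pt a b"
      by blast
  qed
  then obtain a b where "\<forall>i. (a i, b i) \<noteq> (0, 0) \<and> P $ i = proj_pt (a i) (b i)"
    unfolding choice_iff by blast
  then have "homog_coords (\<lambda>v. case v of HX i \<Rightarrow> a i | HY i \<Rightarrow> b i) P"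
    by (simp add: homog_coords_def)
  then show ?thesis by blast
qed

lemma UNIV_hvar: "(UNIV :: 'g hvar set) = range HX \<union> range HY"
proof -
  have "v \<in> range HX \<union> range HY" for v :: "'g hvar"
    by (cases v) auto
  then show ?thesis by auto
qed

lemma prod_hvar:
  fixes h :: "'g::finite hvar \<Rightarrow> complex"
  shows "prod h UNIV = (\<Prod>i\<in>UNIV. h (HX i) * h (HY i))"
proof -
  have "prod h UNIV = prod h (range HX) * prod h (range HY)"
    unfolding UNIV_hvar by (rule prod.union_disjoint) auto
  also have "\<dots> = (\<Prod>i\<in>UNIV. h (HX i)) * (\<Prod>i\<in>UNIV. h (HY i))"
    by (simp add: prod.reindex inj_on_def)
  finally show ?thesis by (simp add: prod.distrib)
qed

lemma hpoly_vanishes_iff: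
  fixes p :: "'g::finite hpoly"
  assumes "multihomogeneous p" "homog_coords u P"
  shows "hpoly_vanishes p P \<longleftrightarrow> hpoly_eval p u = 0"
proof -
  have fin: "finite (UNIV :: 'g hvar set)"
    unfolding UNIV_hvar by simp
  have mono: "(\<Prod>v \<in> Poly_Mapping.keys m. w v ^ Poly_Mapping.lookup m v) =
      (\<Prod>i\<in>UNIV. w (HX i) ^ Poly_Mapping.lookup m (HX i) * w (HY i) ^ Poly_Mapping.lookup m (HY i))"
    for m and w :: "'g hvar \<Rightarrow> complex"
  proof -
    have "(\<Prod>v \<in> Poly_Mapping.keys m. w v ^ Poly_Mapping.lookup m v) =
        (\<Prod>v\<in>UNIV. w v ^ Poly_Mapping.lookup m v)"
      by (rule prod.mono_neutral_left[OF fin]) (auto simp: in_keys_iff)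
    then show ?thesis by (simp only: prod_hvar)
  qed
  have "hpoly_eval p w = 0" if w: "homog_coords w P" and z: "hpoly_eval p u = 0" for w
  proof -
    have "\<forall>i. \<exists>r. w (HX i) = r * u (HX i) \<and> w (HY i) = r * u (HY i)"
    proof
      fix i
      have "(u (HX i), u (HY i)) \<noteq> (0, 0)" "(w (HX i), w (HY i)) \<noteq> (0, 0)"
        "proj_pt (u (HX i)) (u (HY i)) = proj_pt (w (HX i)) (w (HY i))"
        using assms(2)[unfolded homog_coords_def, rule_format, of i]
          w[unfolded homog_coords_def, rule_format, of i] by simp_all
      from iffD1[OF proj_pt_eq_iff[OF this(1,2)] this(3)]
      show "\<exists>r. w (HX i) = r * u (HX i) \<and> w (HY i) = r * u (HY i)"
        by blast
    qed
    then obtain r where r: "\<And>i. w (HX i) = r i * u (HX i)" "\<And>i. w (HY i) = r i * u (HY i)"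
      unfolding choice_iff by blast
    obtain d where d: "\<And>m i. m \<in> Poly_Mapping.keys p \<Longrightarrow>
        Poly_Mapping.lookup m (HX i) + Poly_Mapping.lookup m (HY i) = d i"
      using assms(1) unfolding multihomogeneous_def by blast
    have "hpoly_eval p w = (\<Prod>i\<in>UNIV. r i ^ d i) * hpoly_eval p u"
      unfolding hpoly_eval_def mono[of w] mono[of u] sum_distrib_left
    proof (rule sum.cong[OF refl])
      fix m assume m: "m \<in> Poly_Mapping.keys p"
      have "(\<Prod>i\<in>UNIV. w (HX i) ^ Poly_Mapping.lookup m (HX i) * w (HY i) ^ Poly_Mapping.lookup m (HY i)) =
        (\<Prod>i\<in>UNIV. r i ^ d i * (u (HX i) ^ Poly_Mapping.lookup m (HX i) * u (HY i) ^ Poly_Mapping.lookup m (HY i)))"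
      proof (rule prod.cong[OF refl])
        fix i
        show "w (HX i) ^ Poly_Mapping.lookup m (HX i) * w (HY i) ^ Poly_Mapping.lookup m (HY i) =
          r i ^ d i * (u (HX i) ^ Poly_Mapping.lookup m (HX i) * u (HY i) ^ Poly_Mapping.lookup m (HY i))"
          unfolding d[OF m, of i, symmetric] r power_mult_distrib power_add by (simp only: mult_ac)
      qed
      then show "of_rat (Poly_Mapping.lookup p m) *
          (\<Prod>i\<in>UNIV. w (HX i) ^ Poly_Mapping.lookup m (HX i) * w (HY i) ^ Poly_Mapping.lookup m (HY i)) =
        (\<Prod>i\<in>UNIV. r i ^ d i) * (of_rat (Poly_Mapping.lookup p m) *
          (\<Prod>i\<in>UNIV. u (HX i) ^ Poly_Mapping.lookup m (HX i) * u (HY i) ^ Poly_Mapping.lookup m (HY i)))"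
        by (simp only: prod.distrib mult_ac)
    qed
    then show ?thesis using z by simp
  qed
  then show ?thesis
    using assms(2) unfolding hpoly_vanishes_def by blast
qed

end

theory Submission
  imports Defs "HOL-Analysis.Elementary_Metric_Spaces" "HOL-Analysis.Infinite_Sum"
begin

text \<open>The proof is archimedean and rests on the fact that all coordinates are squared up to a constant,
so that they escape to infinity at the same doubly exponential rate.

An integer orbit \<open>y n\<close> of \<open>t\<^sup>2 + c\<close> is either eventually periodic or eventually larger than any
given bound (\<open>int_quad_orbit_dichotomy\<close>). In the second case the orbit enters the region near
infinity where \<open>t\<^sup>2 + c\<close> is conjugate to \<open>w\<^sup>2\<close>: there is a convergent Laurent series
\<open>F w = w + \<dots>\<close> in \<open>1 / w\<close> with \<open>F (w\<^sup>2) = (F w)\<^sup>2 + c\<close>, the inverse of the Boettcher coordinate.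
Hence \<open>y (n + k) = F (w ^ 2 ^ k)\<close> for a real \<open>w > 1\<close> and all \<open>k\<close>, which exhibits the orbit as a
convergent sum of terms \<open>a * \<mu> ^ 2 ^ k\<close> with \<open>\<mu> > 0\<close>, only finitely many of the \<open>\<mu>\<close> exceeding any
given \<open>\<epsilon> > 0\<close> (\<open>quad_orbit_near_infinity\<close>). Sequences of this kind form a ring that contains the
constants, so a polynomial evaluated along several such orbits is again of this kind.

Such a sequence obeys a strong zero principle (\<open>double_exp_sum_eq_0\<close>). After collecting equal
\<open>\<mu>\<close>, either every coefficient is zero and the sequence vanishes identically, or the term with the
largest \<open>\<mu>\<close> dominates and there are only finitely many zeros. It matters here that the \<open>\<mu>\<close> are
positive reals: complex \<open>\<mu>\<close> of equal modulus could cancel infinitely often.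

Let \<open>K\<close> be a common period of the eventually periodic coordinates. On each residue class modulo
\<open>K\<close> these are eventually constant, so the zero principle applies to every equation of \<open>V\<close>: if
infinitely many points of the orbit in that class lie on \<open>V\<close>, then all of them do from some index
on. That index depends only on the orbit and not on the equation, because the expansions converge
from a fixed index on; this is why infinite families of equations cause no difficulty. The
points on \<open>V\<close> therefore make up finitely many singletons and finitely many progressions of
difference \<open>K\<close>.\<close>

section \<open>Convergent sums of doubly exponential terms\<close>

text \<open>The finiteness condition makes the set of bases \<open>\<mu> i\<close> well-ordered from above, so that there is a
leading term. Repeated bases are allowed, which spares collecting terms when sums are multiplied.\<close>

definition double_exp_sum :: "(nat \<Rightarrow> real) \<Rightarrow> bool" where
  "double_exp_sum s \<longleftrightarrow> (\<exists>(I :: nat set) a \<mu>. (\<forall>i\<in>I. 0 < \<mu> i) \<and>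
     (\<forall>\<epsilon>>0. finite {i\<in>I. \<epsilon> \<le> \<mu> i}) \<and>
     (\<forall>m. ((\<lambda>i. a i * \<mu> i ^ (2 ^ m)) has_sum s m) I))"

text \<open>The definition cannot quantify over types of indices; encoding a countable type into the natural
numbers makes disjoint unions and products available as index sets.\<close>

lemma double_exp_sumI:
  fixes I :: "'i::countable set" and a \<mu> :: "'i \<Rightarrow> real"
  assumes pos: "\<And>i. i \<in> I \<Longrightarrow> 0 < \<mu> i"
    and fin: "\<And>\<epsilon>. \<epsilon> > 0 \<Longrightarrow> finite {i\<in>I. \<epsilon> \<le> \<mu> i}"
    and sum: "\<And>m. ((\<lambda>i. a i * \<mu> i ^ (2 ^ m)) has_sum s m) I"
  shows "double_exp_sum s"
  unfolding double_exp_sum_def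
proof (intro exI conjI)
  have inj: "inj_on to_nat I" by (meson inj_on_subset inj_to_nat subset_UNIV)
  show "\<forall>j\<in>to_nat ` I. 0 < (\<mu> \<circ> from_nat) j" using pos by auto
  show "\<forall>\<epsilon>>0. finite {j\<in>to_nat ` I. \<epsilon> \<le> (\<mu> \<circ> from_nat) j}"
  proof (intro allI impI)
    fix \<epsilon> :: real assume "\<epsilon> > 0"
    then have "finite (to_nat ` {i\<in>I. \<epsilon> \<le> \<mu> i})" using fin by simp
    moreover have "{j\<in>to_nat ` I. \<epsilon> \<le> (\<mu> \<circ> from_nat) j} = to_nat ` {i\<in>I. \<epsilon> \<le> \<mu> i}" by auto
    ultimately show "finite {j\<in>to_nat ` I. \<epsilon> \<le> (\<mu> \<circ> from_nat) j}" by simp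
  qed
  show "\<forall>m. ((\<lambda>j. (a \<circ> from_nat) j * (\<mu> \<circ> from_nat) j ^ (2 ^ m)) has_sum s m) (to_nat ` I)"
    using sum by (simp add: has_sum_reindex[OF inj] o_def)
qed

lemma double_exp_sumE:
  assumes "double_exp_sum s"
  obtains I :: "nat set" and a \<mu> where "\<And>i. i \<in> I \<Longrightarrow> 0 < \<mu> i"
    "\<And>\<epsilon>. \<epsilon> > 0 \<Longrightarrow> finite {i\<in>I. \<epsilon> \<le> \<mu> i}"
    "\<And>m. ((\<lambda>i. a i * \<mu> i ^ (2 ^ m)) has_sum s m) I"
  using assms unfolding double_exp_sum_def by blast

lemma double_exp_sum_const: "double_exp_sum (\<lambda>_. b)"
  by (rule double_exp_sumI[of "{()}" "\<lambda>_. 1" "\<lambda>_. b"]) (auto simp: has_sum_finite_iff)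

lemma double_exp_sum_add:
  assumes "double_exp_sum s" "double_exp_sum t"
  shows "double_exp_sum (\<lambda>m. s m + t m)"
proof -
  obtain I :: "nat set" and a \<mu> where 1: "\<And>i. i \<in> I \<Longrightarrow> 0 < \<mu> i"
    "\<And>\<epsilon>. \<epsilon> > 0 \<Longrightarrow> finite {i\<in>I. \<epsilon> \<le> \<mu> i}"
    "\<And>m. ((\<lambda>i. a i * \<mu> i ^ (2 ^ m)) has_sum s m) I" by (rule double_exp_sumE[OF assms(1)]) blast
  obtain J :: "nat set" and b \<nu> where 2: "\<And>i. i \<in> J \<Longrightarrow> 0 < \<nu> i"
    "\<And>\<epsilon>. \<epsilon> > 0 \<Longrightarrow> finite {i\<in>J. \<epsilon> \<le> \<nu> i}"
    "\<And>m. ((\<lambda>i. b i * \<nu> i ^ (2 ^ m)) has_sum t m) J" by (rule double_exp_sumE[OF assms(2)]) blast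
  show ?thesis
  proof (rule double_exp_sumI[of "Inl ` I \<union> Inr ` J" "case_sum \<mu> \<nu>" "case_sum a b"])
    show "0 < case_sum \<mu> \<nu> i" if "i \<in> Inl ` I \<union> Inr ` J" for i using that 1(1) 2(1) by auto
    show "finite {i \<in> Inl ` I \<union> Inr ` J. \<epsilon> \<le> case_sum \<mu> \<nu> i}" if "\<epsilon> > 0" for \<epsilon>
    proof (rule finite_subset)
      show "finite (Inl ` {i\<in>I. \<epsilon> \<le> \<mu> i} \<union> Inr ` {i\<in>J. \<epsilon> \<le> \<nu> i})" using 1(2) 2(2) that by simp
    qed auto
    show "((\<lambda>i. case_sum a b i * case_sum \<mu> \<nu> i ^ 2 ^ m) has_sum s m + t m) (Inl ` I \<union> Inr ` J)" for m
      by (rule has_sum_Un_disjoint) (use 1(3) 2(3) in \<open>auto simp: has_sum_reindex o_def\<close>)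
  qed
qed

lemma has_sum_times_real:
  fixes f :: "'a \<Rightarrow> real" and g :: "'b \<Rightarrow> real"
  assumes f: "(f has_sum S) A" and g: "(g has_sum T) B"
  shows "((\<lambda>(x, y). f x * g y) has_sum S * T) (A \<times> B)"
proof (rule has_sum_SigmaI[where g = "\<lambda>x. f x * T"])
  show "((\<lambda>y. case (x, y) of (x, y) \<Rightarrow> f x * g y) has_sum f x * T) B" for x
    using has_sum_cmult_right[OF g, of "f x"] by simp
  show "((\<lambda>x. f x * T) has_sum S * T) A" by (rule has_sum_cmult_left[OF f])
  have fa: "(\<lambda>x. norm (f x)) summable_on A"
    by (rule summable_on_iff_abs_summable_on_real[THEN iffD1, OF has_sum_imp_summable[OF f]])
  have ga: "(\<lambda>x. norm (g x)) summable_on B"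
    by (rule summable_on_iff_abs_summable_on_real[THEN iffD1, OF has_sum_imp_summable[OF g]])
  have "(\<lambda>(x, y). f x * g y) abs_summable_on A \<times> B"
    unfolding abs_summable_on_Sigma_iff
  proof (intro conjI ballI)
    fix x
    show "(\<lambda>y. norm (case (x, y) of (x, y) \<Rightarrow> f x * g y)) summable_on B"
      using summable_on_cmult_right[OF ga, of "\<bar>f x\<bar>"] by (simp add: abs_mult)
  next
    have "(\<Sum>\<^sub>\<infinity>y\<in>B. norm (case (x, y) of (x, y) \<Rightarrow> f x * g y)) = \<bar>f x\<bar> * (\<Sum>\<^sub>\<infinity>y\<in>B. \<bar>g y\<bar>)" for x
      using infsum_cmult_right[where f = "\<lambda>y. \<bar>g y\<bar>" and A = B and c = "\<bar>f x\<bar>"] ga by (simp add: abs_mult)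
    then show "(\<lambda>x. norm (\<Sum>\<^sub>\<infinity>y\<in>B. norm (case (x, y) of (x, y) \<Rightarrow> f x * g y))) summable_on A"
      using summable_on_cmult_left[OF fa, of "\<bar>\<Sum>\<^sub>\<infinity>y\<in>B. \<bar>g y\<bar>\<bar>"] by (simp add: abs_mult)
  qed
  then show "(\<lambda>(x, y). f x * g y) summable_on A \<times> B"
    by (rule summable_on_iff_abs_summable_on_real[THEN iffD2])
qed

text \<open>A product \<open>\<mu> i * \<nu> j \<ge> \<epsilon>\<close> of bounded factors forces both factors away from 0, so only finitely
many pairs of indices occur.\<close>

lemma double_exp_sum_mult:
  assumes "double_exp_sum s" "double_exp_sum t"
  shows "double_exp_sum (\<lambda>m. s m * t m)"
proof -
  obtain I :: "nat set" and a \<mu> where 1: "\<And>i. i \<in> I \<Longrightarrow> 0 < \<mu> i"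
    "\<And>\<epsilon>. \<epsilon> > 0 \<Longrightarrow> finite {i\<in>I. \<epsilon> \<le> \<mu> i}"
    "\<And>m. ((\<lambda>i. a i * \<mu> i ^ (2 ^ m)) has_sum s m) I" by (rule double_exp_sumE[OF assms(1)]) blast
  obtain J :: "nat set" and b \<nu> where 2: "\<And>i. i \<in> J \<Longrightarrow> 0 < \<nu> i"
    "\<And>\<epsilon>. \<epsilon> > 0 \<Longrightarrow> finite {i\<in>J. \<epsilon> \<le> \<nu> i}"
    "\<And>m. ((\<lambda>i. b i * \<nu> i ^ (2 ^ m)) has_sum t m) J" by (rule double_exp_sumE[OF assms(2)]) blast
  have bdd: "\<exists>M>0. \<forall>i\<in>K. \<kappa> i \<le> M" if "finite {i\<in>K. 1 \<le> \<kappa> i}" for K :: "nat set" and \<kappa> :: "nat \<Rightarrow> real"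
  proof (intro exI conjI ballI)
    let ?M = "Max (insert 1 (\<kappa> ` {i\<in>K. 1 \<le> \<kappa> i}))"
    show "0 < ?M" using that by (auto simp: Max_gr_iff)
    show "\<kappa> i \<le> ?M" if "i \<in> K" for i
      using that \<open>finite {i\<in>K. 1 \<le> \<kappa> i}\<close> by (cases "1 \<le> \<kappa> i") (auto simp: Max_ge_iff)
  qed
  obtain M where M: "M > 0" "\<And>i. i \<in> I \<Longrightarrow> \<mu> i \<le> M" using bdd[OF 1(2)[of 1]] by auto
  obtain M' where M': "M' > 0" "\<And>i. i \<in> J \<Longrightarrow> \<nu> i \<le> M'" using bdd[OF 2(2)[of 1]] by auto
  show ?thesis
  proof (rule double_exp_sumI[of "I \<times> J" "\<lambda>(i, j). \<mu> i * \<nu> j" "\<lambda>(i, j). a i * b j"])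
    show "0 < (case p of (i, j) \<Rightarrow> \<mu> i * \<nu> j)" if "p \<in> I \<times> J" for p using that 1(1) 2(1) by auto
    show "finite {p \<in> I \<times> J. \<epsilon> \<le> (case p of (i, j) \<Rightarrow> \<mu> i * \<nu> j)}" if "\<epsilon> > 0" for \<epsilon>
    proof (rule finite_subset)
      show "finite ({i\<in>I. \<epsilon> / M' \<le> \<mu> i} \<times> {j\<in>J. \<epsilon> / M \<le> \<nu> j})"
        using 1(2) 2(2) that M(1) M'(1) by simp
      have "\<epsilon> / M' \<le> \<mu> i \<and> \<epsilon> / M \<le> \<nu> j" if ij: "i \<in> I" "j \<in> J" "\<epsilon> \<le> \<mu> i * \<nu> j" for i j
      proof -
        have "\<mu> i * \<nu> j \<le> \<mu> i * M'" "\<mu> i * \<nu> j \<le> M * \<nu> j"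
          using M(2) M'(2) 1(1) 2(1) ij by (simp_all add: less_imp_le)
        then show ?thesis using ij(3) M(1) M'(1) by (simp add: field_simps)
      qed
      then show "{p \<in> I \<times> J. \<epsilon> \<le> (case p of (i, j) \<Rightarrow> \<mu> i * \<nu> j)}
          \<subseteq> {i\<in>I. \<epsilon> / M' \<le> \<mu> i} \<times> {j\<in>J. \<epsilon> / M \<le> \<nu> j}" by auto
    qed
    show "((\<lambda>p. (case p of (i, j) \<Rightarrow> a i * b j) * (case p of (i, j) \<Rightarrow> \<mu> i * \<nu> j) ^ 2 ^ m)
        has_sum s m * t m) (I \<times> J)" for m
      using has_sum_times_real[OF 1(3)[of m] 2(3)[of m]]
      by (simp add: case_prod_unfold power_mult_distrib mult_ac)
  qed
qed

lemma double_exp_sum_power: "double_exp_sum s \<Longrightarrow> double_exp_sum (\<lambda>m. s m ^ n)"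
  by (induction n) (auto intro: double_exp_sum_const double_exp_sum_mult)

lemma double_exp_sum_sum: "(\<And>x. x \<in> A \<Longrightarrow> double_exp_sum (s x)) \<Longrightarrow> double_exp_sum (\<lambda>m. \<Sum>x\<in>A. s x m)"
  by (induction A rule: infinite_finite_induct) (auto intro: double_exp_sum_const double_exp_sum_add)

lemma double_exp_sum_prod: "(\<And>x. x \<in> A \<Longrightarrow> double_exp_sum (s x)) \<Longrightarrow> double_exp_sum (\<lambda>m. \<Prod>x\<in>A. s x m)"
  by (induction A rule: infinite_finite_induct) (auto intro: double_exp_sum_const double_exp_sum_mult)

text \<open>Collect the terms with the same base \<open>v\<close> into one coefficient \<open>D v\<close>. If all of these are 0,
summing over the fibres first gives 0 for every \<open>m\<close>. If some \<open>D v\<close> is nonzero,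
take the largest such \<open>v\<close>: all smaller bases are bounded by some \<open>w < v\<close>, so together they
contribute at most \<open>C * w ^ (2 ^ m - 1)\<close>, which is eventually smaller than \<open>\<bar>D v\<bar> * v ^ 2 ^ m\<close>.\<close>

lemma double_exp_sum_eq_0:
  assumes s: "double_exp_sum s" and zeros: "infinite {m. s m = 0}"
  shows "s m = 0"
proof -
  obtain I :: "nat set" and a \<mu> where pos: "\<And>i. i \<in> I \<Longrightarrow> 0 < \<mu> i"
    and fin: "\<And>\<epsilon>. \<epsilon> > 0 \<Longrightarrow> finite {i\<in>I. \<epsilon> \<le> \<mu> i}"
    and sum: "\<And>m. ((\<lambda>i. a i * \<mu> i ^ (2 ^ m)) has_sum s m) I" by (rule double_exp_sumE[OF s]) blast
  define D where "D v = (\<Sum>i | i \<in> I \<and> \<mu> i = v. a i)" for v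
  have fibre: "finite {i\<in>I. \<mu> i = v}" if "v \<in> \<mu> ` I" for v
    by (rule finite_subset[OF _ fin[of v]]) (use that pos in auto)
  have fibre_sum: "(\<Sum>i | i \<in> I \<and> \<mu> i = v. a i * \<mu> i ^ 2 ^ m) = D v * v ^ 2 ^ m" for v m
    by (simp add: D_def sum_distrib_right)
  show ?thesis
  proof (cases "\<forall>v \<in> \<mu> ` I. D v = 0")
    case True
    have "((\<lambda>(v, i). a i * \<mu> i ^ 2 ^ m) has_sum s m) (SIGMA v:\<mu> ` I. {i\<in>I. \<mu> i = v})"
      using sum[of m]
      by (subst has_sum_reindex_bij_witness[of _ "\<lambda>i. (\<mu> i, i)" snd I]) auto
    then have "((\<lambda>v. D v * v ^ 2 ^ m) has_sum s m) (\<mu> ` I)"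
      by (rule has_sum_Sigma') (simp add: has_sum_finite_iff fibre D_def sum_distrib_right)
    then have "((\<lambda>v. 0) has_sum s m) (\<mu> ` I)"
      by (rule iffD1[OF has_sum_cong, rotated]) (use True in auto)
    then show ?thesis by (rule has_sum_unique) simp
  next
    case False
    then obtain v0 where v0: "v0 \<in> \<mu> ` I" "D v0 \<noteq> 0" by blast
    define X where "X = {v \<in> \<mu> ` I. v0 \<le> v \<and> D v \<noteq> 0}"
    have "finite (\<mu> ` {i\<in>I. v0 \<le> \<mu> i})" using fin v0 pos by auto
    then have finX: "finite X" by (rule finite_subset[rotated]) (auto simp: X_def)
    define v where "v = Max X"
    have "v \<in> X" unfolding v_def using finX v0 by (intro Max_in) (auto simp: X_def)
    then have v: "v \<in> \<mu> ` I" "D v \<noteq> 0" "v0 \<le> v" by (auto simp: X_def)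
    then have vpos: "v > 0" using pos by auto
    have vmax: "D u = 0" if "u \<in> \<mu> ` I" "u > v" for u
    proof (rule ccontr)
      assume "D u \<noteq> 0"
      then have "u \<in> X" using that v(3) by (simp add: X_def)
      then have "u \<le> v" unfolding v_def by (rule Max_ge[OF finX])
      then show False using that(2) by simp
    qed
    define H where "H = {i\<in>I. v \<le> \<mu> i}"
    have finH: "finite H" unfolding H_def using fin vpos by blast
    have head: "(\<Sum>i\<in>H. a i * \<mu> i ^ 2 ^ m) = D v * v ^ 2 ^ m" for m
    proof -
      have "(\<Sum>i\<in>H. a i * \<mu> i ^ 2 ^ m) = (\<Sum>u\<in>\<mu> ` H. \<Sum>i | i \<in> H \<and> \<mu> i = u. a i * \<mu> i ^ 2 ^ m)"
        by (rule sum.image_gen[OF finH])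
      also have "\<dots> = (\<Sum>u\<in>\<mu> ` H. D u * u ^ 2 ^ m)"
      proof (rule sum.cong[OF refl])
        fix u assume "u \<in> \<mu> ` H"
        then have "{i. i \<in> H \<and> \<mu> i = u} = {i. i \<in> I \<and> \<mu> i = u}" by (auto simp: H_def)
        then show "(\<Sum>i | i \<in> H \<and> \<mu> i = u. a i * \<mu> i ^ 2 ^ m) = D u * u ^ 2 ^ m"
          by (simp only: fibre_sum)
      qed
      also have "\<dots> = (\<Sum>u\<in>{v}. D u * u ^ 2 ^ m)"
      proof (rule sum.mono_neutral_right)
        show "{v} \<subseteq> \<mu> ` H" using v(1) by (auto simp: H_def)
        show "\<forall>u\<in>\<mu> ` H - {v}. D u * u ^ 2 ^ m = 0"
        proof
          fix u assume u: "u \<in> \<mu> ` H - {v}"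
          then have "u \<in> \<mu> ` I" "v \<le> u" "u \<noteq> v" by (auto simp: H_def)
          then show "D u * u ^ 2 ^ m = 0" using vmax[of u] by simp
        qed
      qed (use finH in simp)
      finally show ?thesis by simp
    qed
    \<comment> \<open>Only finitely many bases lie in \<open>[v / 2, v)\<close>, hence the gap below \<open>v\<close>.\<close>
    obtain w where w: "0 < w" "w < v" "\<And>i. i \<in> I - H \<Longrightarrow> \<mu> i \<le> w"
    proof
      let ?A = "{i \<in> I - H. v / 2 \<le> \<mu> i}"
      let ?w = "Max (insert (v / 2) (\<mu> ` ?A))"
      have fA: "finite ?A" by (rule finite_subset[OF _ fin[of "v/2"]]) (use vpos in auto)
      show "?w < v" using fA vpos by (auto simp: H_def)
      show "0 < ?w" using fA vpos by (auto simp: Max_gr_iff)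
      show "\<mu> i \<le> ?w" if "i \<in> I - H" for i
        using fA that by (cases "v / 2 \<le> \<mu> i") (auto simp: Max_ge_iff)
    qed
    \<comment> \<open>The tail at exponent \<open>2 ^ 0 = 1\<close>; one factor \<open>\<mu> i\<close> stays inside \<open>C\<close>, the others are
      bounded by \<open>w\<close>.\<close>
    define C where "C = (\<Sum>\<^sub>\<infinity>i\<in>I - H. \<bar>a i * \<mu> i\<bar>)"
    have summ: "(\<lambda>i. a i * \<mu> i ^ 2 ^ m) summable_on (I - H)" for m
      using sum[of m] by (meson Diff_subset has_sum_imp_summable summable_on_subset_banach)
    then have asumm: "(\<lambda>i. norm (a i * \<mu> i ^ 2 ^ m)) summable_on (I - H)" for m
      by (rule summable_on_iff_abs_summable_on_real[THEN iffD1])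
    have tail: "\<bar>s m - D v * v ^ 2 ^ m\<bar> \<le> C * w ^ (2 ^ m - 1)" for m
    proof -
      have "((\<lambda>i. a i * \<mu> i ^ 2 ^ m) has_sum D v * v ^ 2 ^ m + (\<Sum>\<^sub>\<infinity>i\<in>I - H. a i * \<mu> i ^ 2 ^ m)) (H \<union> (I - H))"
        by (rule has_sum_Un_disjoint) (use finH summ in \<open>auto simp: has_sum_finite_iff head\<close>)
      moreover have "H \<union> (I - H) = I" by (auto simp: H_def)
      ultimately have "s m - D v * v ^ 2 ^ m = (\<Sum>\<^sub>\<infinity>i\<in>I - H. a i * \<mu> i ^ 2 ^ m)"
        using has_sum_unique[OF sum[of m]] by fastforce
      also have "\<bar>\<dots>\<bar> \<le> (\<Sum>\<^sub>\<infinity>i\<in>I - H. norm (a i * \<mu> i ^ 2 ^ m))"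
        using norm_infsum_bound[OF asumm] by simp
      also have "\<dots> \<le> (\<Sum>\<^sub>\<infinity>i\<in>I - H. \<bar>a i * \<mu> i\<bar> * w ^ (2 ^ m - 1))"
      proof (rule infsum_mono)
        show "(\<lambda>i. \<bar>a i * \<mu> i\<bar> * w ^ (2 ^ m - 1)) summable_on I - H"
          using asumm[of 0] by (intro summable_on_cmult_left) simp
        fix i assume i: "i \<in> I - H"
        have "\<mu> i ^ (2 ^ m) = \<mu> i * \<mu> i ^ (2 ^ m - 1)"
          by (metis power_minus_mult mult.commute zero_less_numeral zero_less_power)
        moreover have "\<mu> i ^ (2 ^ m - 1) \<le> w ^ (2 ^ m - 1)" "0 < \<mu> i"
          using w(3)[OF i] pos[of i] i by (auto intro: power_mono)
        ultimately show "norm (a i * \<mu> i ^ 2 ^ m) \<le> \<bar>a i * \<mu> i\<bar> * w ^ (2 ^ m - 1)"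
          by (simp add: abs_mult mult.assoc mult_left_mono)
      qed (rule asumm)
      also have "\<dots> = C * w ^ (2 ^ m - 1)"
        unfolding C_def using asumm[of 0] by (intro infsum_cmult_left) simp
      finally show ?thesis .
    qed
    have C0: "C \<ge> 0" unfolding C_def by (rule infsum_nonneg) simp
    have "(\<lambda>m. C * (w / v) ^ m) \<longlonglongrightarrow> C * 0"
      by (intro tendsto_intros LIMSEQ_realpow_zero) (use w in auto)
    then have "\<forall>\<^sub>F m in sequentially. C * (w / v) ^ m < \<bar>D v\<bar> * v"
      by (rule order_tendstoD) (use v vpos in auto)
    then obtain m0 where m0: "\<And>m. m \<ge> m0 \<Longrightarrow> C * (w / v) ^ m < \<bar>D v\<bar> * v"
      by (auto simp: eventually_sequentially)
    have "m < m0" if "s m = 0" for m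
    proof (rule ccontr)
      assume "\<not> m < m0"
      have "(2::nat) ^ m - 1 \<ge> m" using less_exp[of m] by linarith
      then have "(w / v) ^ (2 ^ m - 1) \<le> (w / v) ^ m"
        using w by (intro power_decreasing) auto
      then have "C * (w / v) ^ (2 ^ m - 1) < \<bar>D v\<bar> * v"
        using m0[of m] \<open>\<not> m < m0\<close> mult_left_mono[OF _ C0] by (meson leI le_less_trans)
      then have "C * w ^ (2 ^ m - 1) < \<bar>D v\<bar> * (v * v ^ (2 ^ m - 1))"
        using vpos by (simp add: power_divide field_simps)
      also have "v * v ^ (2 ^ m - 1) = v ^ 2 ^ m"
        by (metis power_minus_mult mult.commute zero_less_numeral zero_less_power)
      finally show False using tail[of m] that vpos by (simp add: abs_mult)
    qed
    then have "{m. s m = 0} \<subseteq> {..<m0}" by auto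
    then show ?thesis using zeros finite_subset by blast
  qed
qed

section \<open>The inverse Boettcher coordinate at infinity\<close>

text \<open>Writing \<open>F w = w * G (1 / w)\<close>, the equation \<open>F (w\<^sup>2) = (F w)\<^sup>2 + c\<close> becomes
\<open>G (u)\<^sup>2 = G (u\<^sup>2) - c * u\<^sup>2\<close>. Comparing coefficients of \<open>u ^ m\<close> determines the power series
\<open>G = 1 + \<dots>\<close> recursively.\<close>

function inv_bottcher_coeff :: "real \<Rightarrow> nat \<Rightarrow> real" where
  "inv_bottcher_coeff c m = (if m = 0 then 1
     else ((if even m then inv_bottcher_coeff c (m div 2) else 0) - (if m = 2 then c else 0)
       - (\<Sum>j\<in>{1..<m}. inv_bottcher_coeff c j * inv_bottcher_coeff c (m - j))) / 2)"
  by pat_completeness auto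
termination by (relation "measure snd") auto

declare inv_bottcher_coeff.simps [simp del]

lemma inv_bottcher_coeff_0 [simp]: "inv_bottcher_coeff c 0 = 1" by (simp add: inv_bottcher_coeff.simps)

lemma inv_bottcher_coeff_convolution:
  "(\<Sum>j\<le>m. inv_bottcher_coeff c j * inv_bottcher_coeff c (m - j)) = (if even m then inv_bottcher_coeff c (m div 2) else 0) - (if m = 2 then c else 0)"
proof (cases "m = 0")
  case False
  then have "{..m} = insert 0 (insert m {1..<m})" by auto
  then show ?thesis using False inv_bottcher_coeff.simps[of c m] by simp
qed simp

text \<open>This gives a positive radius of convergence. Let \<open>P M\<close> be the partial sum on the left. Taking absolute
values in the recursion yields \<open>2 * P (M + 1) \<le> r * P M + \<bar>c\<bar> * r\<^sup>2 + (P M)\<^sup>2\<close>, because the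
convolution in the recursion for a coefficient involves only earlier coefficients of positive
index. The bound \<open>1 / 2\<close> reproduces itself: \<open>1 / 4 + 1 / 2 + 1 / 4 = 2 * (1 / 2)\<close>.\<close>

lemma inv_bottcher_partial_sum_le:
  assumes r: "0 < r" "r \<le> 1 / 2" "\<bar>c\<bar> * r\<^sup>2 \<le> 1 / 2"
  shows "(\<Sum>m=1..M. \<bar>inv_bottcher_coeff c m\<bar> * r ^ m) \<le> 1 / 2"
proof (induction M)
  case (Suc M)
  define q where "q m = \<bar>inv_bottcher_coeff c m\<bar> * r ^ m" for m
  have q0: "q m \<ge> 0" for m using r by (simp add: q_def)
  define A where "A m = (if even m then \<bar>inv_bottcher_coeff c (m div 2)\<bar> * r ^ m else 0)" for m
  define B where "B m = (if m = 2 then \<bar>c\<bar> * r\<^sup>2 else 0)" for m :: nat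
  define C where "C m = (\<Sum>j\<in>{1..<m}. q j * q (m - j))" for m
  have IH: "sum q {1..M} \<le> 1 / 2" using Suc by (simp add: q_def)
  have term_le: "q m \<le> (A m + B m + C m) / 2" if "m \<ge> 1" for m
  proof -
    have "C m = (\<Sum>j\<in>{1..<m}. \<bar>inv_bottcher_coeff c j * inv_bottcher_coeff c (m - j)\<bar>) * r ^ m"
      unfolding C_def q_def sum_distrib_right
      by (rule sum.cong) (auto simp: abs_mult power_add[symmetric] algebra_simps)
    then have *: "\<bar>\<Sum>j\<in>{1..<m}. inv_bottcher_coeff c j * inv_bottcher_coeff c (m - j)\<bar> * r ^ m \<le> C m"
      using r by (simp add: mult_right_mono)
    define X where "X = (if even m then inv_bottcher_coeff c (m div 2) else 0)"
    define Y where "Y = (if m = 2 then c else 0)"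
    define Z where "Z = (\<Sum>j\<in>{1..<m}. inv_bottcher_coeff c j * inv_bottcher_coeff c (m - j))"
    have "inv_bottcher_coeff c m = (X - Y - Z) / 2" using that by (subst inv_bottcher_coeff.simps) (simp add: X_def Y_def Z_def)
    then have "\<bar>inv_bottcher_coeff c m\<bar> \<le> (\<bar>X\<bar> + \<bar>Y\<bar> + \<bar>Z\<bar>) / 2" by (auto simp: abs_if)
    then have "q m \<le> (\<bar>X\<bar> + \<bar>Y\<bar> + \<bar>Z\<bar>) / 2 * r ^ m"
      unfolding q_def using r by (intro mult_right_mono) auto
    also have "\<dots> = (\<bar>X\<bar> * r ^ m + \<bar>Y\<bar> * r ^ m + \<bar>Z\<bar> * r ^ m) / 2" by (simp add: algebra_simps)
    also have "\<bar>X\<bar> * r ^ m = A m" by (simp add: X_def A_def)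
    also have "\<bar>Y\<bar> * r ^ m = B m" by (simp add: Y_def B_def)
    finally show ?thesis using * by (simp add: Z_def)
  qed
  have "sum A {1..Suc M} = sum A ((\<lambda>i. 2 * i) ` {1..Suc M div 2})"
  proof (rule sum.mono_neutral_right)
    show "\<forall>i\<in>{1..Suc M} - (\<lambda>i. 2 * i) ` {1..Suc M div 2}. A i = 0"
    proof
      fix i assume i: "i \<in> {1..Suc M} - (\<lambda>i. 2 * i) ` {1..Suc M div 2}"
      have "odd i"
      proof
        assume "even i"
        then have "i = 2 * (i div 2)" "i div 2 \<in> {1..Suc M div 2}" using i by auto
        then show False using i by blast
      qed
      then show "A i = 0" by (simp add: A_def)
    qed
  qed auto
  also have "\<dots> = (\<Sum>i\<in>{1..Suc M div 2}. A (2 * i))" by (subst sum.reindex) (auto simp: inj_on_def)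
  also have "\<dots> \<le> (\<Sum>i\<in>{1..Suc M div 2}. q i * (1 / 2))"
  proof (rule sum_mono)
    fix i assume i: "i \<in> {1..Suc M div 2}"
    have "r ^ i \<le> r ^ 1" using r i by (intro power_decreasing) auto
    then have "r ^ i * r ^ i \<le> r ^ i * (1 / 2)" using r by (intro mult_left_mono) auto
    then have "r ^ (2 * i) \<le> r ^ i * (1 / 2)" by (simp add: mult_2 power_add)
    from mult_left_mono[OF this, of "\<bar>inv_bottcher_coeff c i\<bar>"] show "A (2 * i) \<le> q i * (1 / 2)" by (simp add: A_def q_def)
  qed
  also have "\<dots> \<le> (\<Sum>i\<in>{1..M}. q i * (1 / 2))"
    by (rule sum_mono2) (use q0 in auto)
  also have "\<dots> \<le> 1 / 4" using IH by (subst sum_distrib_right[symmetric]) linarith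
  finally have a: "sum A {1..Suc M} \<le> 1 / 4" .
  have "sum B {1..Suc M} \<le> \<bar>c\<bar> * r\<^sup>2" by (simp add: B_def)
  with r have b: "sum B {1..Suc M} \<le> 1 / 2" by linarith
  have "sum C {1..Suc M} = (\<Sum>(m, j)\<in>(SIGMA m:{1..Suc M}. {1..<m}). q j * q (m - j))"
    unfolding C_def by (rule sum.Sigma) auto
  also have "\<dots> = (\<Sum>(j, l)\<in>(\<lambda>(m, j). (j, m - j)) ` (SIGMA m:{1..Suc M}. {1..<m}). q j * q l)"
    by (subst sum.reindex) (auto simp: inj_on_def case_prod_unfold)
  also have "\<dots> \<le> (\<Sum>(j, l)\<in>{1..M} \<times> {1..M}. q j * q l)"
    by (rule sum_mono2) (use q0 in auto)
  also have "\<dots> = sum q {1..M} * sum q {1..M}" by (simp add: sum_product sum.cartesian_product)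
  also have "\<dots> \<le> 1 / 2 * (1 / 2)" by (rule mult_mono) (use IH q0 in \<open>auto intro: sum_nonneg\<close>)
  finally have c: "sum C {1..Suc M} \<le> 1 / 4" by simp
  have "sum q {1..Suc M} \<le> (\<Sum>m=1..Suc M. (A m + B m + C m) / 2)"
    by (rule sum_mono) (use term_le in auto)
  also have "\<dots> = (sum A {1..Suc M} + sum B {1..Suc M} + sum C {1..Suc M}) / 2"
    by (simp only: sum.distrib sum_divide_distrib[symmetric])
  finally show ?case using a b c by (simp add: q_def)
qed simp

definition inv_bottcher_fun :: "real \<Rightarrow> real \<Rightarrow> real" where
  "inv_bottcher_fun c u = suminf (\<lambda>m. inv_bottcher_coeff c m * u ^ m)"

lemma summable_inv_bottcher:
  assumes r: "0 < r" "r \<le> 1 / 2" "\<bar>c\<bar> * r\<^sup>2 \<le> 1 / 2" and u: "\<bar>u\<bar> \<le> r"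
  shows "summable (\<lambda>m. norm (inv_bottcher_coeff c m * u ^ m))"
proof (rule summable_comparison_test)
  have "summable (\<lambda>m. \<bar>inv_bottcher_coeff c (Suc m)\<bar> * r ^ Suc m)"
  proof (rule bounded_imp_summable)
    show "(\<Sum>k\<le>n. \<bar>inv_bottcher_coeff c (Suc k)\<bar> * r ^ Suc k) \<le> 1 / 2" for n
    proof -
      have "(\<Sum>k\<le>n. \<bar>inv_bottcher_coeff c (Suc k)\<bar> * r ^ Suc k) = (\<Sum>m=1..Suc n. \<bar>inv_bottcher_coeff c m\<bar> * r ^ m)"
        using sum.shift_bounds_cl_Suc_ivl[of "\<lambda>m. \<bar>inv_bottcher_coeff c m\<bar> * r ^ m" 0 n]
        by (simp add: atMost_atLeast0)
      with inv_bottcher_partial_sum_le[OF r, of "Suc n"] show ?thesis by (simp only:)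
    qed
  qed (use r in simp)
  then show "summable (\<lambda>m. \<bar>inv_bottcher_coeff c m\<bar> * r ^ m)" by (subst (asm) summable_Suc_iff)
  show "\<exists>N. \<forall>n\<ge>N. norm (norm (inv_bottcher_coeff c n * u ^ n)) \<le> \<bar>inv_bottcher_coeff c n\<bar> * r ^ n"
    using u by (auto simp: abs_mult power_abs intro!: mult_left_mono power_mono)
qed

lemma inv_bottcher_fun_square:
  assumes r: "0 < r" "r \<le> 1 / 2" "\<bar>c\<bar> * r\<^sup>2 \<le> 1 / 2" and u: "\<bar>u\<bar> \<le> r"
  shows "(inv_bottcher_fun c u)\<^sup>2 = inv_bottcher_fun c (u\<^sup>2) - c * u\<^sup>2"
proof -
  have "\<bar>u\<bar> * \<bar>u\<bar> \<le> r * 1" using u r by (intro mult_mono) auto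
  then have "\<bar>u\<^sup>2\<bar> \<le> r" by (simp add: power2_eq_square abs_mult)
  then have "(\<lambda>m. inv_bottcher_coeff c m * (u\<^sup>2) ^ m) sums inv_bottcher_fun c (u\<^sup>2)"
    unfolding inv_bottcher_fun_def by (intro summable_sums summable_norm_cancel[OF summable_inv_bottcher[OF r]])
  then have "(\<lambda>m. (\<lambda>k. if even k then inv_bottcher_coeff c (k div 2) * u ^ k else 0) (2 * m)) sums inv_bottcher_fun c (u\<^sup>2)"
    by (simp add: power_mult)
  then have 1: "(\<lambda>k. if even k then inv_bottcher_coeff c (k div 2) * u ^ k else 0) sums inv_bottcher_fun c (u\<^sup>2)"
    by (subst (asm) sums_mono_reindex) (auto simp: strict_mono_def elim!: evenE)
  have 2: "(\<lambda>k. if k = 2 then c * u\<^sup>2 else 0) sums (c * u\<^sup>2)"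
    using sums_If_finite_set[of "{2}" "\<lambda>_. c * u\<^sup>2"] by simp
  have "(\<lambda>k. \<Sum>i\<le>k. (inv_bottcher_coeff c i * u ^ i) * (inv_bottcher_coeff c (k - i) * u ^ (k - i))) sums (inv_bottcher_fun c u * inv_bottcher_fun c u)"
    unfolding inv_bottcher_fun_def using summable_inv_bottcher[OF r u] by (intro Cauchy_product_sums)
  moreover have "(\<Sum>i\<le>k. (inv_bottcher_coeff c i * u ^ i) * (inv_bottcher_coeff c (k - i) * u ^ (k - i)))
      = (if even k then inv_bottcher_coeff c (k div 2) * u ^ k else 0) - (if k = 2 then c * u\<^sup>2 else 0)" for k
  proof -
    have "(\<Sum>i\<le>k. (inv_bottcher_coeff c i * u ^ i) * (inv_bottcher_coeff c (k - i) * u ^ (k - i)))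
        = (\<Sum>i\<le>k. inv_bottcher_coeff c i * inv_bottcher_coeff c (k - i)) * u ^ k"
      unfolding sum_distrib_right
      by (rule sum.cong) (auto simp: power_add[symmetric] algebra_simps)
    then show ?thesis by (simp add: inv_bottcher_coeff_convolution left_diff_distrib)
  qed
  ultimately show ?thesis
    using sums_unique2[OF _ sums_diff[OF 1 2]] by (simp add: power2_eq_square)
qed

lemma abs_inv_bottcher_fun_minus_1_le:
  assumes r: "0 < r" "r \<le> 1 / 2" "\<bar>c\<bar> * r\<^sup>2 \<le> 1 / 2" and u: "\<bar>u\<bar> \<le> r"
  shows "\<bar>inv_bottcher_fun c u - 1\<bar> \<le> 1 / 2"
proof -
  have s: "summable (\<lambda>m. norm (inv_bottcher_coeff c (Suc m) * u ^ Suc m))"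
    using summable_inv_bottcher[OF r u] by (subst summable_Suc_iff)
  have "inv_bottcher_fun c u - 1 = suminf (\<lambda>m. inv_bottcher_coeff c (Suc m) * u ^ Suc m)"
    using suminf_split_head[OF summable_norm_cancel[OF summable_inv_bottcher[OF r u]]]
    by (simp add: inv_bottcher_fun_def)
  also have "\<bar>\<dots>\<bar> \<le> suminf (\<lambda>m. norm (inv_bottcher_coeff c (Suc m) * u ^ Suc m))"
    using summable_norm[OF s] by simp
  also have "\<dots> \<le> 1 / 2"
  proof (rule suminf_le_const[OF s])
    fix n
    have "(\<Sum>i<n. norm (inv_bottcher_coeff c (Suc i) * u ^ Suc i)) \<le> (\<Sum>i<n. \<bar>inv_bottcher_coeff c (Suc i)\<bar> * r ^ Suc i)"
      using u by (intro sum_mono) (auto simp del: power_Suc simp: abs_mult power_abs intro!: mult_left_mono power_mono)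
    also have "\<dots> = (\<Sum>m=1..n. \<bar>inv_bottcher_coeff c m\<bar> * r ^ m)"
      using sum.shift_bounds_Suc_ivl[of "\<lambda>m. \<bar>inv_bottcher_coeff c m\<bar> * r ^ m" 0 n]
      by (simp add: lessThan_atLeast0 atLeastLessThanSuc_atLeastAtMost)
    finally show "(\<Sum>i<n. norm (inv_bottcher_coeff c (Suc i) * u ^ Suc i)) \<le> 1 / 2"
      using inv_bottcher_partial_sum_le[OF r, of n] by simp
  qed
  finally show ?thesis .
qed

section \<open>Orbits of quadratic polynomials\<close>

text \<open>Beyond \<open>F W\<close> every real number is a value of \<open>F\<close> by the intermediate value theorem, say
\<open>y = F w\<close>. The functional equation then gives \<open>F (w ^ 2 ^ k)\<close> for the \<open>k\<close>-th iterate, and the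
Laurent expansion of \<open>F\<close> in \<open>1 / w\<close> is a sum with bases \<open>w * (1 / w) ^ m\<close>.\<close>

lemma quad_orbit_near_infinity:
  "\<exists>T. \<forall>y\<ge>T. \<exists>s. double_exp_sum s \<and> (\<forall>k. s k = ((\<lambda>t. t\<^sup>2 + c) ^^ k) y)"
proof -
  define r where "r = 1 / (2 * (1 + \<bar>c\<bar>))"
  have r12: "0 < r" "r \<le> 1 / 2" by (auto simp: r_def field_simps)
  have "\<bar>c\<bar> * r \<le> 1 / 2" by (auto simp: r_def field_simps)
  then have "\<bar>c\<bar> * r * r \<le> 1 / 2 * 1" using r12 by (intro mult_mono) auto
  then have r: "0 < r" "r \<le> 1 / 2" "\<bar>c\<bar> * r\<^sup>2 \<le> 1 / 2"
    using r12 by (auto simp: power2_eq_square mult.assoc)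
  \<comment> \<open>Twice the inverse radius keeps \<open>1 / w\<close> strictly inside the disc of convergence, as
    continuity requires.\<close>
  define W where "W = 2 / r"
  have W: "W > 1" "W > 0" using r by (auto simp: W_def field_simps)
  define F where "F w = w * inv_bottcher_fun c (1 / w)" for w
  have inv: "\<bar>1 / w\<bar> < r" if "w \<ge> W" for w
  proof -
    have "2 \<le> w * r" using that r by (simp add: W_def field_simps)
    moreover have "w > 0" using that W by simp
    ultimately show ?thesis by (simp add: field_simps)
  qed
  have F_square: "F (w\<^sup>2) = (F w)\<^sup>2 + c" if "w \<ge> W" for w
    using inv_bottcher_fun_square[OF r, of "1 / w"] inv[OF that] that W
    by (simp add: F_def power_mult_distrib power_divide right_diff_distrib)
  have F_ge: "F w \<ge> w / 2" if "w \<ge> W" for w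
  proof -
    have "inv_bottcher_fun c (1 / w) \<ge> 1 / 2"
      using abs_inv_bottcher_fun_minus_1_le[OF r, of "1 / w"] inv[OF that] by linarith
    then show ?thesis using mult_left_mono[of "1/2" _ w] that W by (simp add: F_def)
  qed
  have F_cont: "continuous_on {W..b} F" for b
  proof -
    have "isCont (inv_bottcher_fun c) u" if "\<bar>u\<bar> < r" for u
      unfolding inv_bottcher_fun_def
      by (rule isCont_powser[of _ r]) (use that r summable_norm_cancel[OF summable_inv_bottcher[OF r, of r]] in auto)
    then have G_cont: "isCont (\<lambda>w. inv_bottcher_fun c (1 / w)) w" if "w \<ge> W" for w
      by (rule isCont_o2[rotated]) (use that W inv in auto)
    then have "isCont F w" if "w \<ge> W" for w
      unfolding F_def by (intro isCont_mult continuous_ident G_cont that)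
    then show ?thesis by (intro continuous_at_imp_continuous_on) auto
  qed
  show ?thesis
  proof (intro exI[of _ "F W"] allI impI)
    fix y assume y: "F W \<le> y"
    define b where "b = max W (2 * y)"
    have "y \<le> F b" using F_ge[of b] by (simp add: b_def)
    then obtain w where w: "W \<le> w" "F w = y"
      using IVT'[OF y _ _ F_cont, of b] by (auto simp: b_def)
    have w1: "w > 1" using w W by simp
    have big: "W \<le> w ^ n" if "n > 0" for n
      using power_increasing[of 1 n w] that w w1 by auto
    have iter: "((\<lambda>t. t\<^sup>2 + c) ^^ k) y = F (w ^ 2 ^ k)" for k
    proof (induction k)
      case (Suc k)
      have "w ^ 2 ^ Suc k = (w ^ 2 ^ k)\<^sup>2" by (simp add: power_mult[symmetric] mult.commute)
      then show ?case using Suc F_square[OF big, of "2 ^ k"] by simp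
    qed (simp add: w)
    have "double_exp_sum (\<lambda>k. F (w ^ 2 ^ k))"
    proof (rule double_exp_sumI[of "UNIV :: nat set" "\<lambda>m. w * (1 / w) ^ m" "inv_bottcher_coeff c"])
      show "0 < w * (1 / w) ^ i" for i using w1 by simp
      show "finite {i \<in> UNIV. \<epsilon> \<le> w * (1 / w) ^ i}" if "\<epsilon> > 0" for \<epsilon>
      proof -
        have "(\<lambda>i. w * (1 / w) ^ i) \<longlonglongrightarrow> w * 0"
          by (intro tendsto_intros LIMSEQ_realpow_zero) (use w1 in auto)
        then have "\<forall>\<^sub>F i in sequentially. w * (1 / w) ^ i < \<epsilon>"
          by (rule order_tendstoD) (use that in auto)
        then obtain N where "\<And>i. i \<ge> N \<Longrightarrow> w * (1 / w) ^ i < \<epsilon>"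
          by (auto simp: eventually_sequentially)
        then have "{i \<in> UNIV. \<epsilon> \<le> w * (1 / w) ^ i} \<subseteq> {..<N}" by (force simp: not_le[symmetric])
        then show ?thesis by (rule finite_subset) simp
      qed
      show "((\<lambda>i. inv_bottcher_coeff c i * (w * (1 / w) ^ i) ^ 2 ^ m) has_sum F (w ^ 2 ^ m)) UNIV" for m
      proof -
        let ?v = "w ^ 2 ^ m"
        have "\<bar>1 / ?v\<bar> \<le> r" using inv[OF big[of "2 ^ m"]] by simp
        note sum = summable_inv_bottcher[OF r this]
        have "((\<lambda>i. inv_bottcher_coeff c i * (1 / ?v) ^ i) has_sum inv_bottcher_fun c (1 / ?v)) UNIV"
          unfolding inv_bottcher_fun_def
          by (intro norm_summable_imp_has_sum summable_sums summable_norm_cancel[OF sum] sum)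
        from has_sum_cmult_right[OF this, of ?v]
        have "((\<lambda>i. ?v * (inv_bottcher_coeff c i * (1 / ?v) ^ i)) has_sum F ?v) UNIV" by (simp add: F_def)
        moreover have "?v * (inv_bottcher_coeff c i * (1 / ?v) ^ i) = inv_bottcher_coeff c i * (w * (1 / w) ^ i) ^ 2 ^ m" for i
          by (simp add: power_mult_distrib power_divide power_mult[symmetric] mult.commute)
        ultimately show ?thesis by simp
      qed
    qed
    then show "\<exists>s. double_exp_sum s \<and> (\<forall>k. s k = ((\<lambda>t. t\<^sup>2 + c) ^^ k) y)" using iter by auto
  qed
qed

text \<open>From \<open>\<bar>t\<bar> \<ge> \<bar>c\<bar> + 2\<close> on, squaring outweighs the constant, so an orbit that once leaves a large
interval never returns to it. An integer orbit that stays in the interval takes finitely many values and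
hence repeats one of them.\<close>

lemma int_quad_orbit_dichotomy:
  fixes c x B :: int
  defines "y \<equiv> \<lambda>n. ((\<lambda>t. t\<^sup>2 + c) ^^ n) x"
  shows "(\<exists>n0. \<forall>n\<ge>n0. B \<le> y n) \<or> (\<exists>n0 p. 0 < p \<and> (\<forall>n\<ge>n0. y (n + p) = y n))"
proof -
  define M where "M = max B (\<bar>c\<bar> + 2)"
  have step: "M \<le> t\<^sup>2 + c" if "M \<le> \<bar>t\<bar>" for t
  proof -
    have t: "\<bar>c\<bar> + 2 \<le> \<bar>t\<bar>" using that by (simp add: M_def)
    then have "\<bar>t\<bar> * (\<bar>c\<bar> + 2) \<le> \<bar>t\<bar> * \<bar>t\<bar>" by (intro mult_left_mono) auto
    moreover have "1 * \<bar>c\<bar> \<le> \<bar>t\<bar> * \<bar>c\<bar>" using t by (intro mult_right_mono) auto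
    ultimately have "\<bar>c\<bar> + 2 * \<bar>t\<bar> \<le> \<bar>t\<bar> * \<bar>t\<bar>" by (simp add: algebra_simps)
    then show ?thesis using that by (simp add: power2_eq_square)
  qed
  have y_Suc: "y (Suc n) = (y n)\<^sup>2 + c" for n by (simp add: y_def)
  show ?thesis
  proof (cases "\<exists>n. M \<le> \<bar>y n\<bar>")
    case True
    then obtain n0 where n0: "M \<le> \<bar>y n0\<bar>" by blast
    have "M \<le> y n" if "n \<ge> Suc n0" for n
      using that
    proof (induction n rule: dec_induct)
      case base
      show ?case using step[OF n0] by (simp add: y_Suc)
    next
      case (step n)
      then show ?case using \<open>\<And>t. M \<le> \<bar>t\<bar> \<Longrightarrow> M \<le> t\<^sup>2 + c\<close>[of "y n"] by (simp add: y_Suc)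
    qed
    then have "B \<le> y n" if "n \<ge> Suc n0" for n using that by (force simp: M_def)
    then show ?thesis by blast
  next
    case False
    then have "\<bar>y n\<bar> \<le> M" for n by (meson linear)
    then have "range y \<subseteq> {-M..M}" by (auto simp: abs_le_iff minus_le_iff)
    then have "finite (range y)" by (rule finite_subset) simp
    then have "\<not> inj y" using finite_imageD infinite_UNIV_nat by blast
    then obtain i j where "i < j" "y i = y j" unfolding inj_def by (metis linorder_neqE_nat)
    have "y (n + (j - i)) = y n" if "n \<ge> i" for n
      using that
    proof (induction n rule: dec_induct)
      case base
      show ?case using \<open>i < j\<close> \<open>y i = y j\<close> by simp
    next
      case (step n)
      then show ?case by (simp add: y_Suc)
    qed
    then show ?thesis using \<open>i < j\<close> by (metis zero_less_diff)
  qed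
qed

text \<open>The two alternatives in one form: on residue classes modulo a multiple of its period, a
periodic coordinate agrees with a constant sequence, and a coordinate tending to infinity needs no
restriction. The threshold and the period depend on the coordinate alone, so that finitely many
coordinates can be treated with a common \<open>n1\<close> and \<open>K\<close>.\<close>

lemma int_quad_orbit_on_progressions:
  fixes c x :: int
  defines "y \<equiv> \<lambda>n. ((\<lambda>t. t\<^sup>2 + c) ^^ n) x"
  shows "\<exists>n0 p. 0 < p \<and> (\<forall>n1\<ge>n0. \<forall>K r. p dvd K \<longrightarrow>
    (\<exists>s. double_exp_sum s \<and> (\<forall>m. s (r + m * K) = real_of_int (y (n1 + (r + m * K))))))"
proof -
  obtain T where T: "\<And>t. T \<le> t \<Longrightarrow>
      \<exists>s. double_exp_sum s \<and> (\<forall>k. s k = ((\<lambda>t. t\<^sup>2 + real_of_int c) ^^ k) t)"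
    using quad_orbit_near_infinity by blast
  have shift: "((\<lambda>t. t\<^sup>2 + real_of_int c) ^^ k) (real_of_int (y n)) = real_of_int (y (n + k))" for n k
    by (induction k) (simp_all add: y_def)
  from int_quad_orbit_dichotomy[of "\<lceil>T\<rceil>" c x]
  consider (large) n0 where "\<forall>n\<ge>n0. \<lceil>T\<rceil> \<le> y n"
    | (periodic) n0 p where "0 < p" "\<forall>n\<ge>n0. y (n + p) = y n"
    unfolding y_def by blast
  then show ?thesis
  proof cases
    case large
    have "\<exists>s. double_exp_sum s \<and> (\<forall>m. s (r + m * K) = real_of_int (y (n1 + (r + m * K))))"
      if "n1 \<ge> n0" for n1 K r
    proof -
      have "T \<le> real_of_int (y n1)" using large that by (simp add: ceiling_le_iff)
      from T[OF this] show ?thesis by (auto simp: shift)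
    qed
    then show ?thesis by (intro exI[of _ n0] exI[of _ 1]) auto
  next
    case periodic
    have per: "y (n + m * p) = y n" if "n \<ge> n0" for n m
    proof (induction m)
      case (Suc m)
      have "y (n + Suc m * p) = y ((n + m * p) + p)" by (simp add: algebra_simps)
      also have "\<dots> = y (n + m * p)" using periodic(2) that by simp
      finally show ?case using Suc by simp
    qed simp
    have "\<exists>s. double_exp_sum s \<and> (\<forall>m. s (r + m * K) = real_of_int (y (n1 + (r + m * K))))"
      if "n1 \<ge> n0" "p dvd K" for n1 K r
    proof (intro exI conjI allI)
      show "double_exp_sum (\<lambda>_. real_of_int (y (n1 + r)))" by (rule double_exp_sum_const)
      fix m
      obtain d where "K = p * d" using \<open>p dvd K\<close> by blast
      then have "n1 + (r + m * K) = (n1 + r) + (m * d) * p" by (simp add: algebra_simps)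
      then show "real_of_int (y (n1 + r)) = real_of_int (y (n1 + (r + m * K)))"
        using per[of "n1 + r" "m * d"] \<open>n1 \<ge> n0\<close> by (metis trans_le_add1)
    qed
    then show ?thesis using periodic(1) by (intro exI[of _ n0] exI[of _ p]) auto
  qed
qed

section \<open>Points of an orbit on a subvariety\<close>

text \<open>Residue classes with finitely many elements of \<open>Z\<close>, as well as the elements below \<open>n0\<close>,
contribute singletons, encoded as progressions of difference 0.\<close>

lemma finite_union_of_progressions:
  fixes Z :: "nat set"
  assumes K: "K > 0"
    and Z: "\<And>r. infinite {m. n0 + (r + m * K) \<in> Z} \<Longrightarrow> \<forall>m. n0 + (r + m * K) \<in> Z"
  shows "\<exists>A. finite A \<and> Z = (\<Union>(k, l)\<in>A. {n * k + l | n. True})"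
proof -
  define R where "R = {r. r < K \<and> infinite {m. n0 + (r + m * K) \<in> Z}}"
  define R' where "R' = {r. r < K \<and> finite {m. n0 + (r + m * K) \<in> Z}}"
  define E where "E = {l\<in>Z. l < n0} \<union> (\<Union>r\<in>R'. (\<lambda>m. n0 + (r + m * K)) ` {m. n0 + (r + m * K) \<in> Z})"
  define A where "A = Pair 0 ` E \<union> (\<lambda>r. (K, n0 + r)) ` R"
  have "finite E" unfolding E_def
  proof (intro finite_UnI finite_UN_I finite_imageI)
    show "finite {l\<in>Z. l < n0}" by (rule finite_subset[of _ "{..<n0}"]) auto
    show "finite R'" by (rule finite_subset[of _ "{..<K}"]) (auto simp: R'_def)
  qed (simp add: R'_def)
  moreover have "finite R" by (rule finite_subset[of _ "{..<K}"]) (auto simp: R_def)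
  ultimately have "finite A" by (simp add: A_def)
  moreover have "Z = (\<Union>(k, l)\<in>A. {n * k + l | n. True})"
  proof (intro equalityI subsetI)
    fix l assume l: "l \<in> Z"
    show "l \<in> (\<Union>(k, l)\<in>A. {n * k + l | n. True})"
    proof (cases "l \<in> E")
      case True
      then have "(0, l) \<in> A" by (simp add: A_def)
      then show ?thesis by force
    next
      case False
      define r where "r = (l - n0) mod K"
      define m where "m = (l - n0) div K"
      have "l \<ge> n0" using False l by (auto simp: E_def)
      then have lm: "l = n0 + (r + m * K)" by (simp add: r_def m_def)
      have "r < K" using K by (simp add: r_def)
      moreover have "r \<notin> R'" using False l lm by (auto simp: E_def)
      ultimately have "(K, n0 + r) \<in> A" by (auto simp: A_def R_def R'_def)
      moreover have "l = m * K + (n0 + r)" using lm by simp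
      ultimately show ?thesis by blast
    qed
  next
    fix l assume "l \<in> (\<Union>(k, l)\<in>A. {n * k + l | n. True})"
    then consider "l \<in> E" | r n where "r \<in> R" "l = n * K + (n0 + r)" by (auto simp: A_def)
    then show "l \<in> Z"
    proof cases
      case 1
      then show ?thesis by (auto simp: E_def)
    next
      case 2
      have "infinite {m. n0 + (r + m * K) \<in> Z}" using 2(1) unfolding R_def by blast
      from Z[OF this] have "n0 + (r + n * K) \<in> Z" by blast
      also have "n0 + (r + n * K) = l" using 2(2) by simp
      finally show ?thesis .
    qed
  qed
  ultimately show ?thesis by blast
qed

text \<open>At a point with integer coordinates the equations take real values; this is the same polynomial
evaluated in the reals, where the ordering of the bases is available.\<close>

definition hpoly_real :: "'g hpoly \<Rightarrow> ('g hvar \<Rightarrow> real) \<Rightarrow> real" where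
  "hpoly_real p u = (\<Sum>m \<in> Poly_Mapping.keys p.
     of_rat (Poly_Mapping.lookup p m) * (\<Prod>v \<in> Poly_Mapping.keys m. u v ^ Poly_Mapping.lookup m v))"

lemma of_real_of_rat: "complex_of_real (of_rat q) = of_rat q"
  by (cases q) (simp add: of_rat_rat)

lemma hpoly_eval_of_real: "hpoly_eval p (\<lambda>v. complex_of_real (u v)) = complex_of_real (hpoly_real p u)"
  by (simp add: hpoly_eval_def hpoly_real_def of_real_of_rat)

lemma double_exp_sum_hpoly:
  assumes "\<And>v. double_exp_sum (s v)"
  shows "double_exp_sum (\<lambda>k. hpoly_real p (\<lambda>v. s v k))"
  unfolding hpoly_real_def
  by (intro double_exp_sum_sum double_exp_sum_mult double_exp_sum_const double_exp_sum_prod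
      double_exp_sum_power assms)

definition affine_coords :: "int ^ 'g::finite \<Rightarrow> 'g hvar \<Rightarrow> real" where
  "affine_coords z v = (case v of HX i \<Rightarrow> of_int (z $ i) | HY i \<Rightarrow> 1)"

lemma affine_embed_vanishes_iff:
  assumes "multihomogeneous p"
  shows "hpoly_vanishes p (affine_embed (int_point z)) \<longleftrightarrow> hpoly_real p (affine_coords z) = 0"
proof -
  have "homog_coords (\<lambda>v. complex_of_real (affine_coords z v)) (affine_embed (int_point z))"
    by (simp add: homog_coords_def affine_coords_def affine_embed_def int_point_def)
  from hpoly_vanishes_iff[OF assms this] show ?thesis by (simp add: hpoly_eval_of_real)
qed

lemma quad_map_iterate_int_point:
  "(quad_map c ^^ n) (int_point x) = int_point (\<chi> i. ((\<lambda>t. t\<^sup>2 + c $ i) ^^ n) (x $ i))"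
  by (induction n) (simp_all add: int_point_def quad_map_def vec_eq_iff)

theorem theorem1p7:
  fixes V :: "(proj_line ^ 'g::finite) set"
    and c x :: "int ^ 'g"
  assumes "subvariety_over_Q V"
  shows "\<exists>A :: (nat \<times> nat) set. finite A \<and>
    rational_points V \<inter> affine_embed ` forward_orbit (quad_map c) (int_point x) =
    (\<Union>(k, l)\<in>A. {affine_embed ((quad_map c ^^ (n * k + l)) (int_point x)) | n. True})"
proof -
  obtain S where S: "\<And>p. p \<in> S \<Longrightarrow> multihomogeneous p"
    and V: "V = {P. \<forall>p \<in> S. hpoly_vanishes p P}"
    using assms unfolding subvariety_over_Q_def by blast
  define y where "y n = (\<chi> i. ((\<lambda>t. t\<^sup>2 + c $ i) ^^ n) (x $ i))" for n
  define \<alpha> where "\<alpha> n = affine_embed ((quad_map c ^^ n) (int_point x))" for n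
  have \<alpha>: "\<alpha> n = affine_embed (int_point (y n))" for n
    by (simp add: \<alpha>_def y_def quad_map_iterate_int_point)
  define Z where "Z = {n. \<alpha> n \<in> V}"
  have Z: "n \<in> Z \<longleftrightarrow> (\<forall>p\<in>S. hpoly_real p (affine_coords (y n)) = 0)" for n
    using S by (auto simp: Z_def V \<alpha> affine_embed_vanishes_iff)

  \<comment> \<open>For each coordinate \<open>i\<close>, a threshold \<open>n0\<close> and a period \<open>p\<close>.\<close>
  define Q where "Q i n0 p \<longleftrightarrow> 0 < p \<and> (\<forall>n1\<ge>n0. \<forall>K r. p dvd K \<longrightarrow>
      (\<exists>s. double_exp_sum s \<and> (\<forall>m. s (r + m * K) = real_of_int (y (n1 + (r + m * K)) $ i))))"
    for i n0 p
  have "\<forall>i. \<exists>n0 p. Q i n0 p"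
    unfolding Q_def y_def vec_lambda_beta by (rule allI, rule int_quad_orbit_on_progressions)
  then obtain n0 p where Q: "\<And>i. Q i (n0 i) (p i)"
    unfolding choice_iff by blast
  have p: "0 < p i" for i using Q[of i] by (simp add: Q_def)
  have coord: "\<exists>s. double_exp_sum s \<and> (\<forall>m. s (r + m * K) = real_of_int (y (n1 + (r + m * K)) $ i))"
    if "n0 i \<le> n1" "p i dvd K" for i n1 K r
    using Q[of i, unfolded Q_def] that by blast
  define n1 where "n1 = (\<Sum>i\<in>UNIV. n0 i)"
  define K where "K = (\<Prod>i\<in>UNIV. p i)"
  have n1: "n0 i \<le> n1" for i unfolding n1_def by (rule member_le_sum) auto
  have K: "p i dvd K" for i unfolding K_def by (rule dvd_prodI) auto
  have "K > 0" using p by (simp add: K_def prod_pos)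

  have "\<forall>m. n1 + (r + m * K) \<in> Z" if inf: "infinite {m. n1 + (r + m * K) \<in> Z}" for r
  proof -
    have "\<forall>i. \<exists>s. double_exp_sum s \<and> (\<forall>m. s (r + m * K) = real_of_int (y (n1 + (r + m * K)) $ i))"
      using coord[OF n1 K] by blast
    then obtain s where s: "\<And>i. double_exp_sum (s i)"
      "\<And>i m. s i (r + m * K) = real_of_int (y (n1 + (r + m * K)) $ i)"
      unfolding choice_iff by blast
    define t where "t v = (case v of HX i \<Rightarrow> s i | HY i \<Rightarrow> (\<lambda>_. 1))" for v
    have t: "double_exp_sum (t v)" for v
      by (simp add: t_def s double_exp_sum_const split: hvar.split)
    have t_eq: "(\<lambda>v. t v (r + m * K)) = affine_coords (y (n1 + (r + m * K)))" for m
      by (auto simp: t_def affine_coords_def s split: hvar.split)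
    \<comment> \<open>The sequence of values of \<open>q\<close> along \<open>t\<close> agrees with those along the orbit on the
      class of \<open>r\<close> only, but the zeros there suffice to make it vanish for all \<open>k\<close>.\<close>
    have "hpoly_real q (affine_coords (y (n1 + (r + m * K)))) = 0" if q: "q \<in> S" for q m
    proof -
      have "inj_on (\<lambda>m. r + m * K) {m. n1 + (r + m * K) \<in> Z}"
        using \<open>K > 0\<close> by (auto simp: inj_on_def)
      then have "infinite ((\<lambda>m. r + m * K) ` {m. n1 + (r + m * K) \<in> Z})"
        using inf finite_imageD by blast
      moreover have "(\<lambda>m. r + m * K) ` {m. n1 + (r + m * K) \<in> Z}
          \<subseteq> {k. hpoly_real q (\<lambda>v. t v k) = 0}"
        using q by (auto simp: Z t_eq)
      ultimately have "infinite {k. hpoly_real q (\<lambda>v. t v k) = 0}"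
        using finite_subset by blast
      from double_exp_sum_eq_0[OF double_exp_sum_hpoly[of t q, OF t] this, of "r + m * K"]
      show ?thesis by (simp add: t_eq)
    qed
    then show ?thesis by (simp add: Z)
  qed
  from finite_union_of_progressions[OF \<open>K > 0\<close> this]
  obtain A where A: "finite A" "Z = (\<Union>(k, l)\<in>A. {n * k + l | n. True})" by blast

  have "\<alpha> n \<in> rational_points V \<longleftrightarrow> n \<in> Z" for n
  proof -
    have "\<exists>a b :: rat. (a, b) \<noteq> (0, 0) \<and> \<alpha> n $ i = proj_pt (of_rat a) (of_rat b)" for i
      by (rule exI[of _ "of_int (y n $ i)"], rule exI[of _ 1])
        (simp add: \<alpha> affine_embed_def int_point_def)
    then show ?thesis by (simp add: rational_points_def Z_def)
  qed
  moreover have "affine_embed ` forward_orbit (quad_map c) (int_point x) = range \<alpha>"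
    by (auto simp: forward_orbit_def \<alpha>_def)
  ultimately have "rational_points V \<inter> affine_embed ` forward_orbit (quad_map c) (int_point x) = \<alpha> ` Z"
    by auto
  also have "\<dots> = (\<Union>(k, l)\<in>A. {\<alpha> (n * k + l) | n. True})"
    unfolding A(2) by auto
  finally show ?thesis using A(1) unfolding \<alpha>_def by blast
qed

end
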